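(* Let $(\sigma,\tau_0,\tau_1)$ be one of the 18 triples listed in the context and suppose that $T_{\sigma,\tau_0,\tau_1}$ is ergodic with respect to the Lebesgue measure $\lambda$ on $\triangle$, with associated invariant measure $\mu(A)=\int_A r(x,y)\,dx\,dy$, where $r$ is the density assigned to the triple in the context. If $\mu$ and $\lambda$ are mutually absolutely continuous, then for every $k\ge 0$ and for almost every $(x,y)\in\triangle$ the limit $P_k(x,y)$ exists and equals $$p(k)=\int_{\triangle_k}d\mu .$$
   Context: Let $\triangle=\{(x,y)\in\mathbb{R}^2: 0<y<x<1\}$. Triangle partition maps. The elements of $S_3$ are written $e,12,13,23,123,132$ and identified with the $3\times 3$ permutation matrices acting on column vectors $v=(v_1,v_2,v_3)^T$ by: $e\,v=v$, $(12)v=(v_2,v_1,v_3)^T$, $(13)v=(v_3,v_2,v_1)^T$, $(23)v=(v_1,v_3,v_2)^T$, $(123)v=(v_2,v_3,v_1)^T$, $(132)v=(v_3,v_1,v_2)^T$. Put $$B=\begin{pmatrix}1&1&1\\0&1&1\\0&0&1\end{pmatrix},\quad A_0=\begin{pmatrix}0&0&1\\1&0&0\\0&1&1\end{pmatrix},\quad A_1=\begin{pmatrix}1&0&1\\0&1&0\\0&0&1\end{pmatrix}.$$ For $(\sigma,\tau_0,\tau_1)\in S_3^3$ let $F_0=\sigma A_0\tau_0$, $F_1=\sigma A_1\tau_1$ (matrix products). For $k\ge 0$ and $(x,y)\in\triangle$ write $(d_k,p_k,q_k)^T=BF_1^kF_0B^{-1}(1,x,y)^T$ and $S_k(x,y)=(p_k/d_k,\,q_k/d_k)$;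 here $d_k>0$. $S_k$ maps $\triangle$ bijectively onto an open subtriangle $\triangle_k\subset\triangle$; the $\triangle_k$ are pairwise disjoint and (for the triples considered here) cover $\triangle$ up to a null set. The triangle partition map $T=T_{\sigma,\tau_0,\tau_1}$ is defined on $\bigcup_k\triangle_k$ by $T=S_k^{-1}$ on $\triangle_k$. The $(\sigma,\tau_0,\tau_1)$ expansion of (almost every) $(x,y)\in\triangle$ is the sequence $(a_1,a_2,\dots)$ of nonnegative integers with $T^{i-1}(x,y)\in\triangle_{a_i}$. Set $P_{n,k}(x,y)=\frac{\#\{i:1\le i\le n,\ a_i=k\}}{n}$ and, if the limit exists, $P_k(x,y)=\lim_{n\to\infty}P_{n,k}(x,y)$. $p(k)$ denotes the common value of $P_k(x,y)$ for almost all $(x,y)\in\triangle$. Densities $r$: $(e,e,e)$: $\frac{12}{\pi^2x(y+1)}$; $(e,23,e)$, $(e,132,e)$, $(13,23,13)$, $(13,132,13)$: $\frac{6}{\pi^2x(1-y)}$; $(12,12,12)$: $\frac{12}{\pi^2(y+1)(1-x+y)}$; $(12,13,12)$, $(12,123,12)$, $(123,13,132)$, $(123,123,132)$: $\frac{6}{\pi^2(1-y)(1-x+y)}$; $(13,13,13)$: $\frac{12}{\pi^2(2-x)(1-y)}$; $(23,e,23)$, $(23,12,23)$, $(132,e,123)$, $(132,12,123)$: $\frac{6}{\pi^2x(1-x+y)}$; $(23,23,23)$: $\frac{12}{\pi^2x(x-y+1)}$; $(123,132,132)$: $\frac{12}{\pi^2(1-y)(x-y+1)}$; $(132,123,123)$: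 $\frac{12}{\pi^2(2-x)(1-x+y)}$. *)

theory Defs
  imports "HOL-Analysis.Analysis"
begin

definition unit_triangle :: "(real \<times> real) set" where
  "unit_triangle = {(x, y). 0 < y \<and> y < x \<and> x < 1}"

datatype perm3 = PE | P12 | P13 | P23 | P123 | P132

fun perm_vec :: "perm3 \<Rightarrow> real ^ 3 \<Rightarrow> real ^ 3" where
  "perm_vec PE v = v"
| "perm_vec P12 v = vector [v $ 2, v $ 1, v $ 3]"
| "perm_vec P13 v = vector [v $ 3, v $ 2, v $ 1]"
| "perm_vec P23 v = vector [v $ 1, v $ 3, v $ 2]"
| "perm_vec P123 v = vector [v $ 2, v $ 3, v $ 1]"
| "perm_vec P132 v = vector [v $ 3, v $ 1, v $ 2]"

definition perm_mat :: "perm3 \<Rightarrow> real ^ 3 ^ 3" where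
  "perm_mat s = matrix (perm_vec s)"

definition B_mat :: "real ^ 3 ^ 3" where
  "B_mat = vector [vector [1, 1, 1], vector [0, 1, 1], vector [0, 0, 1]]"

definition A0_mat :: "real ^ 3 ^ 3" where
  "A0_mat = vector [vector [0, 0, 1], vector [1, 0, 0], vector [0, 1, 1]]"

definition A1_mat :: "real ^ 3 ^ 3" where
  "A1_mat = vector [vector [1, 0, 1], vector [0, 1, 0], vector [0, 0, 1]]"

(* The power operation of the type real ^ 3 ^ 3 is componentwise, hence a separate matrix power. *)
primrec mat_pow :: "real ^ 3 ^ 3 \<Rightarrow> nat \<Rightarrow> real ^ 3 ^ 3" where
  "mat_pow A 0 = mat 1"
| "mat_pow A (Suc k) = A ** mat_pow A k"

type_synonym triple = "perm3 \<times> perm3 \<times> perm3"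

definition F0_mat :: "triple \<Rightarrow> real ^ 3 ^ 3" where
  "F0_mat = (\<lambda>(\<sigma>, \<tau>0, \<tau>1). perm_mat \<sigma> ** A0_mat ** perm_mat \<tau>0)"

definition F1_mat :: "triple \<Rightarrow> real ^ 3 ^ 3" where
  "F1_mat = (\<lambda>(\<sigma>, \<tau>0, \<tau>1). perm_mat \<sigma> ** A1_mat ** perm_mat \<tau>1)"

definition dpq :: "triple \<Rightarrow> nat \<Rightarrow> real \<times> real \<Rightarrow> real ^ 3" where
  "dpq t k = (\<lambda>(x, y).
     (B_mat ** mat_pow (F1_mat t) k ** F0_mat t ** matrix_inv B_mat) *v vector [1, x, y])"

definition branch :: "triple \<Rightarrow> nat \<Rightarrow> real \<times> real \<Rightarrow> real \<times> real" where
  "branch t k z = (dpq t k z $ 2 / dpq t k z $ 1, dpq t k z $ 3 / dpq t k z $ 1)"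

definition subtriangle :: "triple \<Rightarrow> nat \<Rightarrow> (real \<times> real) set" where
  "subtriangle t k = branch t k ` unit_triangle"

definition tp_domain :: "triple \<Rightarrow> (real \<times> real) set" where
  "tp_domain t = (\<Union>k. subtriangle t k)"

definition cell_index :: "triple \<Rightarrow> real \<times> real \<Rightarrow> nat" where
  "cell_index t z = (THE k. z \<in> subtriangle t k)"

(* Only the values on tp_domain t are meaningful; everything below restricts to that set. *)
definition tp_map :: "triple \<Rightarrow> real \<times> real \<Rightarrow> real \<times> real" where
  "tp_map t z = inv_into unit_triangle (branch t (cell_index t z)) z"

definition has_expansion :: "triple \<Rightarrow> real \<times> real \<Rightarrow> bool" where
  "has_expansion t z \<longleftrightarrow> (\<forall>i\<ge>1. (tp_map t ^^ (i - 1)) z \<in> tp_domain t)"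

(* The digit a_i, for i \<ge> 1; meaningful when has_expansion t z holds. *)
definition digit :: "triple \<Rightarrow> real \<times> real \<Rightarrow> nat \<Rightarrow> nat" where
  "digit t z i = cell_index t ((tp_map t ^^ (i - 1)) z)"

definition digit_freq :: "triple \<Rightarrow> nat \<Rightarrow> nat \<Rightarrow> real \<times> real \<Rightarrow> real" where
  "digit_freq t n k z = real (card {i. 1 \<le> i \<and> i \<le> n \<and> digit t z i = k}) / real n"

definition has_digit_density :: "triple \<Rightarrow> nat \<Rightarrow> real \<times> real \<Rightarrow> real \<Rightarrow> bool" where
  "has_digit_density t k z c \<longleftrightarrow>
     has_expansion t z \<and> (\<lambda>n. digit_freq t n k z) \<longlonglongrightarrow> c"

definition digit_density :: "triple \<Rightarrow> nat \<Rightarrow> real" where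
  "digit_density t k = (THE c. AE z in lebesgue_on unit_triangle. has_digit_density t k z c)"

(* In the next two definitions T is a partial map with domain D, so that the preimage of A
   is the set of points z of D with T z in A. *)
definition invariant_under :: "'a measure \<Rightarrow> 'a set \<Rightarrow> ('a \<Rightarrow> 'a) \<Rightarrow> bool" where
  "invariant_under M D T \<longleftrightarrow>
     (\<forall>A \<in> sets M. {z \<in> D. T z \<in> A} \<in> sets M \<and> emeasure M {z \<in> D. T z \<in> A} = emeasure M A)"

definition ergodic_wrt :: "'a measure \<Rightarrow> 'a set \<Rightarrow> ('a \<Rightarrow> 'a) \<Rightarrow> bool" where
  "ergodic_wrt M D T \<longleftrightarrow>
     (\<forall>A \<in> sets M. {z \<in> D. T z \<in> A} = A \<longrightarrow> A \<in> null_sets M \<or> space M - A \<in> null_sets M)"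

definition density_measure :: "(real \<times> real \<Rightarrow> real) \<Rightarrow> (real \<times> real) measure" where
  "density_measure r = density (lebesgue_on unit_triangle) (\<lambda>z. ennreal (r z))"

definition listed_densities :: "(triple \<times> (real \<times> real \<Rightarrow> real)) set" where
  "listed_densities =
     {(PE, PE, PE)} \<times> {\<lambda>(x, y). 12 / (pi^2 * x * (y + 1))} \<union>
     {(PE, P23, PE), (PE, P132, PE), (P13, P23, P13), (P13, P132, P13)}
       \<times> {\<lambda>(x, y). 6 / (pi^2 * x * (1 - y))} \<union>
     {(P12, P12, P12)} \<times> {\<lambda>(x, y). 12 / (pi^2 * (y + 1) * (1 - x + y))} \<union>
     {(P12, P13, P12), (P12, P123, P12), (P123, P13, P132), (P123, P123, P132)}
       \<times> {\<lambda>(x, y). 6 / (pi^2 * (1 - y) * (1 - x + y))} \<union>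
     {(P13, P13, P13)} \<times> {\<lambda>(x, y). 12 / (pi^2 * (2 - x) * (1 - y))} \<union>
     {(P23, PE, P23), (P23, P12, P23), (P132, PE, P123), (P132, P12, P123)}
       \<times> {\<lambda>(x, y). 6 / (pi^2 * x * (1 - x + y))} \<union>
     {(P23, P23, P23)} \<times> {\<lambda>(x, y). 12 / (pi^2 * x * (x - y + 1))} \<union>
     {(P123, P132, P132)} \<times> {\<lambda>(x, y). 12 / (pi^2 * (1 - y) * (x - y + 1))} \<union>
     {(P132, P123, P123)} \<times> {\<lambda>(x, y). 12 / (pi^2 * (2 - x) * (1 - x + y))}"

end

theory Submission
  imports Defs "HOL-Probability.Probability_Measure"
begin

text \<open>
  The frequency of the digit \<open>k\<close> in the expansion of \<open>z\<close> is the Birkhoff average, along the orbit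
  of \<open>z\<close>, of the indicator function of the cell \<open>subtriangle t k\<close>.  Since \<open>density_measure r\<close> is
  invariant and has the same null sets as Lebesgue measure, the ergodicity of Lebesgue measure carries
  over to it, and the pointwise ergodic theorem gives the limit \<open>\<integral> indicator (subtriangle t k)\<close>
  almost everywhere.  Three ingredients need a proof.

  The pointwise ergodic theorem (\<open>birkhoff_ergodic\<close>).  If \<open>\<integral>g < 0\<close>, the set where the partial sums
  of \<open>g\<close> along the orbit have an infinite supremum is invariant; were it of full measure, the
  running maxima \<open>M n = max 0 (g + M (n - 1) \<circ> T)\<close> would satisfy
  \<open>0 \<le> \<integral>(M (n + 1) - M n) = \<integral>(M (n + 1) - M n \<circ> T) \<longlonglongrightarrow> \<integral>g\<close>, a contradiction.  Hence the partial
  sums are bounded above almost everywhere, and \<open>g = \<plusminus>(f - \<integral>f) - \<epsilon>\<close> yields the theorem.  The triangle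
  map is only partially defined; as the space itself is a measurable set whose preimage has the same
  measure, the points with an infinite orbit form a conull set, on which the map is total
  (\<open>birkhoff_ergodic_partial\<close>).

  The digits are well defined (\<open>cell_index_eq_iff\<close>).  In barycentric coordinates the triangle is the
  projectivised positive orthant, the cells are the images of the orthant under \<open>F\<^sub>1\<^sup>k F\<^sub>0\<close>, and they are
  disjoint because \<open>F\<^sub>0\<close> and \<open>F\<^sub>1\<close> map the orthant injectively into the two sides of a plane.

  The measure has total mass one (\<open>listed_densities_triangle_integral\<close>); otherwise the limit would be
  a quotient of measures.  Measure-preserving affine symmetries of the triangle reduce the nine
  densities to two, and their integrals follow from \<open>\<Sum>1 / n\<^sup>2 = \<pi>\<^sup>2 / 6\<close> by expanding geometric series.
\<close>

section \<open>The pointwise ergodic theorem\<close>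

text \<open>
  Ergodicity is required only for strictly invariant sets, which is the weaker and hence more
  convenient form of the assumption.
\<close>

locale ergodic_system = prob_space M for M :: "'a measure" +
  fixes T :: "'a \<Rightarrow> 'a"
  assumes T_measurable [measurable]: "T \<in> measurable M M"
    and T_preserves: "distr M M T = M"
    and T_ergodic: "\<And>A. A \<in> sets M \<Longrightarrow> T -` A \<inter> space M = A \<Longrightarrow> A \<in> null_sets M \<or> space M - A \<in> null_sets M"
begin

text \<open>
  This is the maximum of \<open>0\<close> and the first \<open>n\<close> partial sums of \<open>g\<close> along the orbit of \<open>x\<close>.  The
  recursion in the starting point, rather than in \<open>n\<close>, is what allows comparison with the maximum
  at \<open>T x\<close>.
\<close>

primrec max_partial_sum :: "('a \<Rightarrow> real) \<Rightarrow> nat \<Rightarrow> 'a \<Rightarrow> real" where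
  "max_partial_sum g 0 x = 0"
| "max_partial_sum g (Suc n) x = max 0 (g x + max_partial_sum g n (T x))"

lemma max_partial_sum_nonneg: "0 \<le> max_partial_sum g n x"
  by (cases n) auto

lemma max_partial_sum_mono_Suc: "max_partial_sum g n x \<le> max_partial_sum g (Suc n) x"
proof (induction n arbitrary: x)
  case (Suc n)
  have "max 0 (g x + max_partial_sum g n (T x)) \<le> max 0 (g x + max_partial_sum g (Suc n) (T x))"
    by (intro max.mono add_mono order_refl Suc)
  then show ?case
    by (simp only: max_partial_sum.simps(2)[of g _ x])
qed auto

lemma max_partial_sum_mono: "m \<le> n \<Longrightarrow> max_partial_sum g m x \<le> max_partial_sum g n x"
  by (rule lift_Suc_mono_le[of "\<lambda>n. max_partial_sum g n x"]) (use max_partial_sum_mono_Suc in auto)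

lemma partial_sum_le_max: "(\<Sum>i<n. g ((T ^^ i) x)) \<le> max_partial_sum g n x"
proof (induction n arbitrary: x)
  case (Suc n)
  have "(\<Sum>i<Suc n. g ((T ^^ i) x)) = g x + (\<Sum>i<n. g ((T ^^ i) (T x)))"
    by (subst sum.lessThan_Suc_shift) (simp add: funpow_swap1)
  then show ?case
    using Suc[of "T x"] by simp
qed simp

lemma integrable_compose_T:
  fixes f :: "'a \<Rightarrow> real"
  assumes "integrable M f"
  shows "integrable M (\<lambda>x. f (T x))" and "(\<integral>x. f (T x) \<partial>M) = (\<integral>x. f x \<partial>M)"
proof -
  have [measurable]: "f \<in> borel_measurable M"
    using assms by auto
  show "integrable M (\<lambda>x. f (T x))"
    using integrable_distr[of T M M f] assms by (simp add: T_preserves)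
  show "(\<integral>x. f (T x) \<partial>M) = (\<integral>x. f x \<partial>M)"
    using integral_distr[of T M M f] by (simp add: T_preserves)
qed

lemma integrable_max_partial_sum:
  assumes "integrable M g"
  shows "integrable M (max_partial_sum g n)"
proof (induction n)
  case 0
  then show ?case by (simp add: fun_eq_iff cong: integrable_cong)
next
  case (Suc n)
  have "integrable M (\<lambda>x. max 0 (g x + max_partial_sum g n (T x)))"
    using assms integrable_compose_T(1)[OF Suc] by (intro integrable_max) auto
  then show ?case by simp
qed

text \<open>
  The difference \<open>M (n + 1) x - M n (T x) = max (- M n (T x)) (g x)\<close> of running maxima is dominated by
  \<open>\<bar>g x\<bar>\<close> and equals \<open>g x\<close> as soon as \<open>M n (T x) \<ge> - g x\<close>.  If the maxima were unbounded almost
  everywhere, dominated convergence would therefore produce \<open>\<integral>g\<close> as a limit of nonnegative numbers.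
\<close>

lemma AE_partial_sums_bounded:
  fixes g :: "'a \<Rightarrow> real"
  assumes g: "integrable M g" and neg: "(\<integral>x. g x \<partial>M) < 0"
  shows "AE x in M. \<exists>C. \<forall>n. (\<Sum>i<n. g ((T ^^ i) x)) \<le> C"
proof -
  let ?m = "max_partial_sum g :: nat \<Rightarrow> 'a \<Rightarrow> real"
  have [measurable]: "g \<in> borel_measurable M" "\<And>n. ?m n \<in> borel_measurable M"
    using g integrable_max_partial_sum[OF g] by auto
  define A where "A = {x \<in> space M. \<forall>c::nat. \<exists>n. real c < ?m n x}"
  have A_sets [measurable]: "A \<in> sets M"
    unfolding A_def by measurable
  have unbounded_T: "(\<forall>c::nat. \<exists>n. real c < ?m n (T x)) \<longleftrightarrow> (\<forall>c::nat. \<exists>n. real c < ?m n x)" for x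
  proof (intro iffI allI)
    fix c :: nat
    assume *: "\<forall>c::nat. \<exists>n. real c < ?m n (T x)"
    obtain d :: nat where d: "real c - g x \<le> real d"
      using real_arch_simple by blast
    obtain n where "real d < ?m n (T x)"
      using * by blast
    then have "real c < ?m (Suc n) x"
      using d by simp
    then show "\<exists>n. real c < ?m n x" ..
  next
    fix c :: nat
    assume *: "\<forall>c::nat. \<exists>n. real c < ?m n x"
    obtain d :: nat where d: "real c + \<bar>g x\<bar> \<le> real d"
      using real_arch_simple by blast
    obtain n where n: "real d < ?m n x"
      using * by blast
    obtain k where k: "n = Suc k"
      using n by (cases n) auto
    have "real c < ?m k (T x)"
      using n d unfolding k by (auto simp: max_def split: if_splits)
    then show "\<exists>n. real c < ?m n (T x)" ..
  qed
  have "T -` A \<inter> space M = A"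
    using measurable_space[OF T_measurable] unbounded_T by (auto simp: A_def)
  then consider "A \<in> null_sets M" | "space M - A \<in> null_sets M"
    using T_ergodic A_sets by blast
  then show ?thesis
  proof cases
    case 1
    show ?thesis
      using AE_not_in[OF 1] AE_space
    proof (eventually_elim, goal_cases)
      case (1 x)
      then obtain c :: nat where "\<forall>n. ?m n x \<le> real c"
        by (auto simp: A_def not_less)
      then show ?case
        using partial_sum_le_max[where g = g and x = x] by (meson order_trans)
    qed
  next
    case 2
    have "AE x in M. (\<lambda>n. ?m (Suc n) x - ?m n (T x)) \<longlonglongrightarrow> g x"
      using AE_not_in[OF 2] AE_space
    proof (eventually_elim, goal_cases)
      case (1 x)
      then have "\<forall>c::nat. \<exists>n. real c < ?m n (T x)"
        using unbounded_T by (auto simp: A_def)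
      moreover obtain c :: nat where "- g x \<le> real c"
        using real_arch_simple by blast
      ultimately obtain N where N: "- g x < ?m N (T x)"
        by (meson le_less_trans)
      have "?m (Suc n) x - ?m n (T x) = g x" if "N \<le> n" for n
        using max_partial_sum_mono[OF that, of g "T x"] N by simp
      then show ?case
        by (intro tendsto_eventually eventually_sequentiallyI[of N]) blast
    qed
    moreover have "\<bar>?m (Suc n) x - ?m n (T x)\<bar> \<le> \<bar>g x\<bar>" for n x
      using max_partial_sum_nonneg[of g n "T x"] by (auto simp: max_def)
    ultimately have "(\<lambda>n. \<integral>x. ?m (Suc n) x - ?m n (T x) \<partial>M) \<longlonglongrightarrow> (\<integral>x. g x \<partial>M)"
      using g by (intro integral_dominated_convergence[where w = "\<lambda>x. \<bar>g x\<bar>"]) auto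
    moreover have "0 \<le> (\<integral>x. ?m (Suc n) x - ?m n (T x) \<partial>M)" for n
    proof -
      note int = integrable_max_partial_sum[OF g]
      have "(\<integral>x. ?m (Suc n) x - ?m n (T x) \<partial>M) = (\<integral>x. ?m (Suc n) x \<partial>M) - (\<integral>x. ?m n x \<partial>M)"
        using integrable_compose_T[OF int, of n] Bochner_Integration.integral_diff[OF int integrable_compose_T(1)[OF int], of "Suc n" n]
        by (simp del: max_partial_sum.simps(2))
      moreover have "(\<integral>x. ?m n x \<partial>M) \<le> (\<integral>x. ?m (Suc n) x \<partial>M)"
        by (intro integral_mono int max_partial_sum_mono_Suc)
      ultimately show ?thesis by simp
    qed
    ultimately have "0 \<le> (\<integral>x. g x \<partial>M)"
      by (intro LIMSEQ_le_const[of _ _ 0]) auto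
    with neg show ?thesis by simp
  qed
qed

text \<open>
  A margin between \<open>\<integral>f\<close> and \<open>c\<close> absorbs the bound on the partial sums of \<open>f - a\<close>, because that bound
  becomes negligible after division by \<open>n\<close>.
\<close>

lemma AE_average_upper:
  fixes f :: "'a \<Rightarrow> real"
  assumes f: "integrable M f" and e: "(\<integral>x. f x \<partial>M) < c"
  shows "AE x in M. eventually (\<lambda>n. (\<Sum>i<n. f ((T ^^ i) x)) / n < c) sequentially"
proof -
  define a where "a = ((\<integral>x. f x \<partial>M) + c) / 2"
  have a: "(\<integral>x. f x \<partial>M) < a" "a < c"
    using e by (auto simp: a_def)
  have "AE x in M. \<exists>C. \<forall>n. (\<Sum>i<n. f ((T ^^ i) x) - a) \<le> C"
    using f a(1) by (intro AE_partial_sums_bounded) (auto simp: prob_space)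
  then show ?thesis
  proof (eventually_elim, goal_cases)
    case (1 x)
    then obtain C where C: "\<And>n. (\<Sum>i<n. f ((T ^^ i) x)) \<le> C + real n * a"
      by (auto simp: sum_subtractf algebra_simps)
    have "eventually (\<lambda>n. C / (c - a) < real n) sequentially"
      using filterlim_at_top_dense[THEN iffD1, OF filterlim_real_sequentially] by blast
    then show ?case
      using eventually_gt_at_top[of 0]
    proof (eventually_elim, goal_cases)
      case (1 n)
      then have "C + real n * a < real n * c"
        using a(2) by (simp add: field_simps)
      with C[of n] 1 show ?case
        by (simp add: field_simps)
    qed
  qed
qed

text \<open>
  The upper estimate is used for \<open>f\<close> and for \<open>- f\<close>, with countably many margins \<open>1 / (j + 1)\<close> so that
  the exceptional null sets can be united.
\<close>

theorem birkhoff_ergodic: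
  fixes f :: "'a \<Rightarrow> real"
  assumes f: "integrable M f"
  shows "AE x in M. (\<lambda>n. (\<Sum>i<n. f ((T ^^ i) x)) / n) \<longlonglongrightarrow> (\<integral>x. f x \<partial>M)"
proof -
  let ?I = "\<integral>x. f x \<partial>M"
  let ?S = "\<lambda>n x. (\<Sum>i<n. f ((T ^^ i) x)) / real n"
  have up: "AE x in M. \<forall>j::nat. eventually (\<lambda>n. ?S n x < ?I + inverse (Suc j)) sequentially"
    unfolding AE_all_countable by (intro allI AE_average_upper f) simp
  have "AE x in M. \<forall>j::nat. eventually (\<lambda>n. (\<Sum>i<n. - f ((T ^^ i) x)) / n < - ?I + inverse (Suc j)) sequentially"
    unfolding AE_all_countable using f by (intro allI AE_average_upper) auto
  with up show ?thesis
  proof (eventually_elim, goal_cases)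
    case (1 x)
    show ?case
    proof (rule tendstoI)
      fix e :: real
      assume "0 < e"
      then obtain j where j: "inverse (Suc j) < e"
        using reals_Archimedean by blast
      show "eventually (\<lambda>n. dist (?S n x) ?I < e) sequentially"
        using 1(1)[rule_format, of j] 1(2)[rule_format, of j]
        by eventually_elim (use j in \<open>auto simp: dist_real_def sum_negf\<close>)
    qed
  qed
qed

end

text \<open>
  The map is replaced by the identity off the set \<open>X\<close> of points with an infinite orbit.  This does not
  disturb invariance or ergodicity, as \<open>X\<close> is a conull set with \<open>{z \<in> D. T z \<in> X} = X\<close>.
\<close>

theorem birkhoff_ergodic_partial:
  fixes T :: "'a \<Rightarrow> 'a" and f :: "'a \<Rightarrow> real"
  assumes "prob_space M"
    and inv: "invariant_under M D T" and erg: "ergodic_wrt M D T"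
    and maps: "\<And>z. z \<in> D \<Longrightarrow> T z \<in> space M"
    and f: "integrable M f"
  shows "AE z in M. (\<forall>i. (T ^^ i) z \<in> D) \<and> (\<lambda>n. (\<Sum>i<n. f ((T ^^ i) z)) / n) \<longlonglongrightarrow> (\<integral>z. f z \<partial>M)"
proof -
  interpret prob_space M by fact
  have pre_sets: "{z \<in> D. T z \<in> A} \<in> sets M"
    and pre_measure: "emeasure M {z \<in> D. T z \<in> A} = emeasure M A" if "A \<in> sets M" for A
    using inv that by (auto simp: invariant_under_def)
  \<comment> \<open>Measurability of the preimage of the whole space forces \<open>D\<close> into the space.\<close>
  have "{z \<in> D. T z \<in> space M} = D"
    using maps by auto
  then have D: "D \<subseteq> space M"
    using pre_sets[of "space M"] sets.sets_into_space by fastforce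
  define Y where "Y n = {z \<in> space M. \<forall>i<n. (T ^^ i) z \<in> D}" for n :: nat
  define X where "X = {z \<in> space M. \<forall>i. (T ^^ i) z \<in> D}"
  have X_D: "z \<in> D" if "z \<in> X" for z
    using that funpow_0[of T z] unfolding X_def by (metis (mono_tags, lifting) mem_Collect_eq)
  have X_T: "T z \<in> X" if "z \<in> X" for z
  proof -
    have "(T ^^ i) (T z) \<in> D" for i
      using that by (auto simp: X_def funpow_swap1 dest: spec[of _ "Suc i"])
    then show ?thesis
      using maps[OF X_D[OF that]] by (simp add: X_def)
  qed
  have X_I: "z \<in> X" if "z \<in> D" "T z \<in> X" for z
  proof -
    have "(T ^^ i) z \<in> D" for i
      using that by (cases i) (simp_all add: X_def funpow_swap1)
    then show ?thesis
      using that(1) D by (auto simp: X_def)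
  qed
  have Y: "Y n \<in> sets M \<and> emeasure M (Y n) = 1" for n
  proof (induction n)
    case 0
    then show ?case
      by (simp add: Y_def emeasure_space_1)
  next
    case (Suc n)
    have "Y (Suc n) = {z \<in> D. T z \<in> Y n}"
      using D maps by (auto simp: Y_def less_Suc_eq_0_disj funpow_swap1)
    then show ?case
      using pre_sets pre_measure Suc by simp
  qed
  have X_eq: "X = (\<Inter>n. Y n)"
    by (auto simp: X_def Y_def)
  have X [measurable]: "X \<in> sets M"
    unfolding X_eq using Y by blast
  have "AE z in M. z \<in> Y n" for n
    using Y[of n] by (intro AE_prob_1) (simp add: measure_def)
  then have AE_X: "AE z in M. z \<in> X"
    unfolding X_eq by (simp add: AE_all_countable)
  define T' where "T' z = (if z \<in> X then T z else z)" for z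
  have pre_T': "T' -` A \<inter> space M = X \<inter> {z \<in> D. T z \<in> A} \<union> (A - X)" if "A \<in> sets M" for A
    using X_D sets.sets_into_space[OF that] sets.sets_into_space[OF X] by (auto simp: T'_def split: if_splits)
  interpret T': ergodic_system M T'
  proof unfold_locales
    show T'_meas [measurable]: "T' \<in> measurable M M"
    proof (rule measurableI)
      show "T' z \<in> space M" if "z \<in> space M" for z
        using that X_D maps by (auto simp: T'_def)
      show "T' -` A \<inter> space M \<in> sets M" if "A \<in> sets M" for A
        unfolding pre_T'[OF that] using that pre_sets[OF that] by auto
    qed
    show "distr M M T' = M"
    proof (rule measure_eqI)
      fix A assume "A \<in> sets (distr M M T')"
      then have A: "A \<in> sets M" by simp
      have "emeasure (distr M M T') A = emeasure M (X \<inter> {z \<in> D. T z \<in> A} \<union> (A - X))"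
        using A by (simp add: emeasure_distr pre_T')
      also have "\<dots> = emeasure M {z \<in> D. T z \<in> A}"
        using pre_sets[OF A] A AE_X by (intro emeasure_eq_AE) auto
      finally show "emeasure (distr M M T') A = emeasure M A"
        using pre_measure[OF A] by simp
    qed simp
    fix A assume A: "A \<in> sets M" "T' -` A \<inter> space M = A"
    have "{z \<in> D. T z \<in> A \<inter> X} = A \<inter> X"
    proof (intro set_eqI iffI)
      fix z
      assume z: "z \<in> {z \<in> D. T z \<in> A \<inter> X}"
      then have "z \<in> X"
        using X_I by auto
      with z show "z \<in> A \<inter> X"
        using A(2) pre_T'[OF A(1)] by auto
    next
      fix z
      assume z: "z \<in> A \<inter> X"
      then have "z \<in> X \<inter> {z \<in> D. T z \<in> A} \<union> (A - X)"
        using A(2) pre_T'[OF A(1)] by simp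
      with z show "z \<in> {z \<in> D. T z \<in> A \<inter> X}"
        using X_T by auto
    qed
    moreover have AX: "A \<inter> X \<in> sets M"
      using A by auto
    ultimately consider "A \<inter> X \<in> null_sets M" | "space M - A \<inter> X \<in> null_sets M"
      using erg by (auto simp: ergodic_wrt_def)
    then show "A \<in> null_sets M \<or> space M - A \<in> null_sets M"
    proof cases
      case 1
      have "AE z in M. z \<notin> A"
        using AE_X AE_not_in[OF 1] by eventually_elim auto
      then show ?thesis
        using A AE_iff_null_sets by blast
    next
      case 2
      then have "space M - A \<in> null_sets M"
        by (rule null_sets_subset) (use A in auto)
      then show ?thesis ..
    qed
  qed
  have orbit: "(T' ^^ i) z = (T ^^ i) z \<and> (T ^^ i) z \<in> X" if "z \<in> X" for i z
    using that X_T by (induction i) (simp_all add: T'_def)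
  show ?thesis
    using T'.birkhoff_ergodic[OF f] AE_X
  proof (eventually_elim, goal_cases)
    case (1 z)
    then show ?case
      using orbit[OF 1(2)] by (simp add: X_def)
  qed
qed

section \<open>The cells as images of the positive orthant\<close>

definition pos_cone :: "(real ^ 3) set" where
  "pos_cone = {v. 0 < v $ 1 \<and> 0 < v $ 2 \<and> 0 < v $ 3}"

definition proj_coords :: "real \<times> real \<Rightarrow> real ^ 3" where
  "proj_coords z = vector [1, fst z, snd z]"

lemma perm_mat_apply: "perm_mat s *v v = perm_vec s v"
  by (cases s)
     (simp_all add: perm_mat_def matrix_def matrix_vector_mult_def vec_eq_iff forall_3 sum_3 axis_def)

lemma perm_vec_pos_cone: "v \<in> pos_cone \<Longrightarrow> perm_vec s v \<in> pos_cone"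
  by (cases s) (auto simp: pos_cone_def)

lemma perm_vec_inj: "perm_vec s v = perm_vec s w \<Longrightarrow> v = w"
  by (cases s) (auto simp: vec_eq_iff forall_3)

lemma A0_apply: "A0_mat *v v = vector [v $ 3, v $ 1, v $ 2 + v $ 3]"
  by (simp add: A0_mat_def vec_eq_iff forall_3 matrix_vector_mult_def sum_3)

lemma A1_apply: "A1_mat *v v = vector [v $ 1 + v $ 3, v $ 2, v $ 3]"
  by (simp add: A1_mat_def vec_eq_iff forall_3 matrix_vector_mult_def sum_3)

lemma B_apply: "B_mat *v v = vector [v $ 1 + v $ 2 + v $ 3, v $ 2 + v $ 3, v $ 3]"
  by (simp add: B_mat_def vec_eq_iff forall_3 matrix_vector_mult_def sum_3)

lemma F0_apply: "F0_mat (s, u, w) *v v = perm_vec s (A0_mat *v perm_vec u v)"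
  by (simp add: F0_mat_def matrix_vector_mul_assoc[symmetric] perm_mat_apply)

lemma F1_apply: "F1_mat (s, u, w) *v v = perm_vec s (A1_mat *v perm_vec w v)"
  by (simp add: F1_mat_def matrix_vector_mul_assoc[symmetric] perm_mat_apply)

lemma F0_pos_cone: "v \<in> pos_cone \<Longrightarrow> F0_mat t *v v \<in> pos_cone"
proof -
  assume v: "v \<in> pos_cone"
  obtain s u w where t: "t = (s, u, w)" by (cases t)
  have "A0_mat *v perm_vec u v \<in> pos_cone"
    using perm_vec_pos_cone[OF v, of u] by (simp add: A0_apply pos_cone_def)
  then show ?thesis
    unfolding t F0_apply by (rule perm_vec_pos_cone)
qed

lemma F1_pos_cone: "v \<in> pos_cone \<Longrightarrow> F1_mat t *v v \<in> pos_cone"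
proof -
  assume v: "v \<in> pos_cone"
  obtain s u w where t: "t = (s, u, w)" by (cases t)
  have "A1_mat *v perm_vec w v \<in> pos_cone"
    using perm_vec_pos_cone[OF v, of w] by (simp add: A1_apply pos_cone_def)
  then show ?thesis
    unfolding t F1_apply by (rule perm_vec_pos_cone)
qed

lemma F0_inj: "F0_mat t *v v = F0_mat t *v w \<Longrightarrow> v = w"
proof -
  obtain s u u' where t: "t = (s, u, u')" by (cases t)
  assume "F0_mat t *v v = F0_mat t *v w"
  then have "A0_mat *v perm_vec u v = A0_mat *v perm_vec u w"
    unfolding t F0_apply by (rule perm_vec_inj)
  then have "perm_vec u v = perm_vec u w"
    by (simp add: A0_apply vec_eq_iff forall_3)
  then show ?thesis
    by (rule perm_vec_inj)
qed

lemma F1_inj: "F1_mat t *v v = F1_mat t *v w \<Longrightarrow> v = w"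
proof -
  obtain s u u' where t: "t = (s, u, u')" by (cases t)
  assume "F1_mat t *v v = F1_mat t *v w"
  then have "A1_mat *v perm_vec u' v = A1_mat *v perm_vec u' w"
    unfolding t F1_apply by (rule perm_vec_inj)
  then have "perm_vec u' v = perm_vec u' w"
    by (simp add: A1_apply vec_eq_iff forall_3)
  then show ?thesis
    by (rule perm_vec_inj)
qed

text \<open>
  Up to the common permutation \<open>\<sigma>\<close>, the image of the orthant under \<open>F\<^sub>0\<close> lies in the half space where
  the third coordinate exceeds the first, and its image under \<open>F\<^sub>1\<close> in the opposite one.
\<close>

lemma F0_F1_disjoint:
  assumes "v \<in> pos_cone" "w \<in> pos_cone"
  shows "F0_mat t *v v \<noteq> F1_mat t *v w"
proof
  assume eq: "F0_mat t *v v = F1_mat t *v w"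
  obtain s u u' where t: "t = (s, u, u')" by (cases t)
  have "A0_mat *v perm_vec u v = A1_mat *v perm_vec u' w"
    using eq unfolding t F0_apply F1_apply by (rule perm_vec_inj)
  then show False
    using perm_vec_pos_cone[OF assms(1), of u] perm_vec_pos_cone[OF assms(2), of u']
    by (simp add: A0_apply A1_apply vec_eq_iff forall_3 pos_cone_def)
qed

lemma F1_pow_pos_cone: "v \<in> pos_cone \<Longrightarrow> mat_pow (F1_mat t) k *v v \<in> pos_cone"
  by (induction k) (auto simp: matrix_vector_mul_assoc[symmetric] F1_pos_cone)

text \<open>
  Cancelling the common power of the injective matrix \<open>F\<^sub>1\<close> leaves a point of \<open>F\<^sub>0 C \<inter> F\<^sub>1 C\<close>, where
  \<open>C\<close> is the orthant.
\<close>

lemma branch_cones_disjoint: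
  assumes "v \<in> pos_cone" "w \<in> pos_cone"
    and "mat_pow (F1_mat t) j *v (F0_mat t *v v) = mat_pow (F1_mat t) k *v (F0_mat t *v w)"
  shows "j = k"
proof -
  have first_cell: "F0_mat t *v x \<noteq> F1_mat t *v (mat_pow (F1_mat t) i *v (F0_mat t *v y))"
    if "x \<in> pos_cone" "y \<in> pos_cone" for x y i
    using that by (intro F0_F1_disjoint F1_pow_pos_cone F0_pos_cone)
  show ?thesis
    using assms(3)
  proof (induction j arbitrary: k)
    case 0
    then show ?case
      using first_cell[OF assms(1,2)] by (cases k) (auto simp: matrix_vector_mul_assoc[symmetric])
  next
    case (Suc j)
    note IH = Suc.IH and step = Suc.prems
    show ?case
    proof (cases k)
      case 0
      then show ?thesis
        using step first_cell[OF assms(2,1), of j] by (simp add: matrix_vector_mul_assoc[symmetric])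
    next
      case (Suc k')
      then show ?thesis
        using step IH[of k'] by (auto simp: matrix_vector_mul_assoc[symmetric] dest: F1_inj)
    qed
  qed
qed

definition branch_mat :: "triple \<Rightarrow> nat \<Rightarrow> real ^ 3 ^ 3" where
  "branch_mat t k = mat_pow (F1_mat t) k ** F0_mat t"

lemma branch_mat_inj: "branch_mat t k *v v = branch_mat t k *v w \<Longrightarrow> v = w"
  unfolding branch_mat_def
  by (induction k) (auto simp: matrix_vector_mul_assoc[symmetric] dest: F1_inj F0_inj)

definition bary :: "real \<times> real \<Rightarrow> real ^ 3" where
  "bary z = vector [1 - fst z, fst z - snd z, snd z]"

lemma B_bary: "B_mat *v bary z = proj_coords z"
  by (simp add: B_apply bary_def proj_coords_def)

text \<open>
  The matrix \<open>B\<close> converts barycentric coordinates of the triangle to homogeneous ones.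
\<close>

lemma B_inv_apply: "matrix_inv B_mat *v proj_coords z = bary z"
proof -
  have "det B_mat \<noteq> 0"
    by (simp add: B_mat_def det_3)
  then have "matrix_inv B_mat ** B_mat = mat 1"
    unfolding invertible_det_nz[symmetric] matrix_inv_def invertible_def by (rule someI2_ex) blast
  then show ?thesis
    by (metis B_bary matrix_vector_mul_assoc matrix_vector_mul_lid)
qed

lemma bary_pos_cone: "bary z \<in> pos_cone \<longleftrightarrow> z \<in> unit_triangle"
  by (cases z) (auto simp: bary_def pos_cone_def unit_triangle_def)

lemma dpq_eq: "dpq t k z = B_mat *v (branch_mat t k *v bary z)"
  using B_inv_apply[of z]
  by (cases z) (simp add: dpq_def branch_mat_def matrix_vector_mul_assoc[symmetric] proj_coords_def)

lemma branch_mat_pos_cone: "v \<in> pos_cone \<Longrightarrow> branch_mat t k *v v \<in> pos_cone"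
  by (simp add: branch_mat_def matrix_vector_mul_assoc[symmetric] F1_pow_pos_cone F0_pos_cone)

lemma pos_cone_scale: "v \<in> pos_cone \<Longrightarrow> 0 < c \<Longrightarrow> c *\<^sub>R v \<in> pos_cone"
  by (simp add: pos_cone_def)

lemma bary_of_projection:
  assumes "v \<in> pos_cone"
  defines "s \<equiv> v $ 1 + v $ 2 + v $ 3"
  shows "bary ((v $ 2 + v $ 3) / s, v $ 3 / s) = (1 / s) *\<^sub>R v"
proof -
  have "s > 0"
    using assms by (auto simp: pos_cone_def)
  then have "1 - (v $ 2 + v $ 3) / s = v $ 1 / s" "(v $ 2 + v $ 3) / s - v $ 3 / s = v $ 2 / s"
    by (simp_all add: s_def divide_simps)
  then show ?thesis
    by (simp add: bary_def vec_eq_iff forall_3)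
qed

text \<open>
  Linearisation of the cells: the fractional linear branch is the linear map \<open>branch_mat t k\<close> read in
  barycentric coordinates, and the scaling by the denominator is harmless because the orthant is a
  cone.
\<close>

lemma mem_subtriangle_iff:
  "z \<in> subtriangle t k \<longleftrightarrow> bary z \<in> (\<lambda>v. branch_mat t k *v v) ` pos_cone"
proof
  assume "z \<in> subtriangle t k"
  then obtain w where w: "w \<in> unit_triangle" "z = branch t k w"
    by (auto simp: subtriangle_def)
  define v where "v = branch_mat t k *v bary w"
  have v: "v \<in> pos_cone"
    unfolding v_def using w bary_pos_cone branch_mat_pos_cone by blast
  define s where "s = v $ 1 + v $ 2 + v $ 3"
  have s: "s > 0"
    using v by (auto simp: pos_cone_def s_def)
  have "bary z = (1 / s) *\<^sub>R v"
    using bary_of_projection[OF v] w by (simp add: branch_def dpq_eq B_apply v_def s_def)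
  also have "\<dots> = branch_mat t k *v ((1 / s) *\<^sub>R bary w)"
    by (simp add: v_def matrix_vector_mult_scaleR)
  finally show "bary z \<in> (\<lambda>v. branch_mat t k *v v) ` pos_cone"
    using s w bary_pos_cone pos_cone_scale[of "bary w" "1 / s"] by auto
next
  assume "bary z \<in> (\<lambda>v. branch_mat t k *v v) ` pos_cone"
  then obtain v where v: "v \<in> pos_cone" "bary z = branch_mat t k *v v"
    by auto
  define s where "s = v $ 1 + v $ 2 + v $ 3"
  have s: "s > 0"
    using v by (auto simp: pos_cone_def s_def)
  define w where "w = ((v $ 2 + v $ 3) / s, v $ 3 / s)"
  have bw: "bary w = (1 / s) *\<^sub>R v"
    using bary_of_projection[OF v(1)] by (simp add: w_def s_def)
  have "w \<in> unit_triangle"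
    using bw pos_cone_scale[OF v(1), of "1 / s"] s bary_pos_cone[of w] by simp
  moreover have "dpq t k w = (1 / s) *\<^sub>R proj_coords z"
    by (simp add: dpq_eq bw matrix_vector_mult_scaleR flip: v(2) B_bary)
  then have "branch t k w = z"
    using s by (simp add: branch_def proj_coords_def)
  ultimately show "z \<in> subtriangle t k"
    by (auto simp: subtriangle_def)
qed

lemma subtriangle_subset: "subtriangle t k \<subseteq> unit_triangle"
proof
  fix z
  assume "z \<in> subtriangle t k"
  then have "bary z \<in> pos_cone"
    using branch_mat_pos_cone[of _ t k] by (auto simp: mem_subtriangle_iff)
  then show "z \<in> unit_triangle"
    by (simp add: bary_pos_cone)
qed

lemma subtriangle_unique:
  assumes "z \<in> subtriangle t j" "z \<in> subtriangle t k"
  shows "j = k"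
proof -
  obtain v w where "v \<in> pos_cone" "w \<in> pos_cone" "branch_mat t j *v v = bary z" "branch_mat t k *v w = bary z"
    using assms unfolding mem_subtriangle_iff by (metis (no_types, lifting) imageE)
  then show ?thesis
    by (intro branch_cones_disjoint[of v w t]) (simp_all add: branch_mat_def matrix_vector_mul_assoc)
qed

lemma cell_index_eq_iff: "z \<in> tp_domain t \<Longrightarrow> cell_index t z = k \<longleftrightarrow> z \<in> subtriangle t k"
proof -
  assume "z \<in> tp_domain t"
  then obtain j where j: "z \<in> subtriangle t j"
    by (auto simp: tp_domain_def)
  then have "cell_index t z = j"
    unfolding cell_index_def using subtriangle_unique by (intro the_equality)
  then show ?thesis
    using j subtriangle_unique by blast
qed

lemma open_subtriangle: "open (subtriangle t k)"
proof -
  have "open ((\<lambda>v. branch_mat t k *v v) ` pos_cone)"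
  proof (rule open_surjective_linear_image)
    show "open pos_cone"
      unfolding pos_cone_def by (intro open_Collect_conj open_Collect_less continuous_intros)
    show "linear ((*v) (branch_mat t k))"
      by simp
    then show "surj ((*v) (branch_mat t k))"
      by (rule eucl.linear_inj_imp_surj) (blast intro: injI branch_mat_inj)
  qed
  moreover have "continuous_on UNIV bary"
  proof -
    have coords: "bary = (\<lambda>z. \<chi> i. if i = 1 then 1 - fst z else if i = 2 then fst z - snd z else snd z)"
      by (simp add: fun_eq_iff bary_def vec_eq_iff forall_3)
    show ?thesis
      unfolding coords
    proof (rule continuous_on_vec_lambda)
      show "continuous_on UNIV (\<lambda>z :: real \<times> real. if i = 1 then 1 - fst z else if i = 2 then fst z - snd z else snd z)"
        for i :: 3
        by (cases "i = 1"; cases "i = 2") (auto intro!: continuous_intros)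
    qed
  qed
  ultimately have "open (bary -` ((\<lambda>v. branch_mat t k *v v) ` pos_cone))"
    by (rule open_vimage)
  then show ?thesis
    by (simp add: vimage_def mem_subtriangle_iff[symmetric])
qed

lemma tp_map_in_triangle: "z \<in> tp_domain t \<Longrightarrow> tp_map t z \<in> unit_triangle"
proof -
  assume "z \<in> tp_domain t"
  then have "z \<in> subtriangle t (cell_index t z)"
    using cell_index_eq_iff by blast
  then show ?thesis
    unfolding tp_map_def subtriangle_def by (rule inv_into_into)
qed

section \<open>Total mass of the invariant measures\<close>

definition triangle_integral :: "(real \<times> real \<Rightarrow> real) \<Rightarrow> ennreal" where
  "triangle_integral f = (\<integral>\<^sup>+z. ennreal (f z) * indicator unit_triangle z \<partial>lborel)"

lemma unit_triangle_borel [measurable]: "unit_triangle \<in> sets borel"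
  unfolding unit_triangle_def case_prod_unfold
  by (intro borel_open open_Collect_conj open_Collect_less continuous_intros)

lemma triangle_integral_cong:
  assumes "\<And>x y. 0 < y \<Longrightarrow> y < x \<Longrightarrow> x < 1 \<Longrightarrow> f (x, y) = g (x, y)"
  shows "triangle_integral f = triangle_integral g"
  unfolding triangle_integral_def
  by (intro nn_integral_cong) (use assms in \<open>auto simp: unit_triangle_def indicator_def\<close>)

lemma triangle_integral_add:
  assumes [measurable]: "f \<in> borel_measurable borel" "g \<in> borel_measurable borel"
    and "\<And>x y. 0 < y \<Longrightarrow> y < x \<Longrightarrow> x < 1 \<Longrightarrow> 0 \<le> f (x, y) \<and> 0 \<le> g (x, y)"
  shows "triangle_integral (\<lambda>z. f z + g z) = triangle_integral f + triangle_integral g"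
proof -
  have "triangle_integral (\<lambda>z. f z + g z) =
      (\<integral>\<^sup>+z. ennreal (f z) * indicator unit_triangle z + ennreal (g z) * indicator unit_triangle z \<partial>lborel)"
    unfolding triangle_integral_def
    by (rule nn_integral_cong)
       (use assms(3) in \<open>auto simp: unit_triangle_def indicator_def\<close>)
  also have "\<dots> = triangle_integral f + triangle_integral g"
    unfolding triangle_integral_def by (rule nn_integral_add) measurable
  finally show ?thesis .
qed

lemma triangle_integral_cmult:
  assumes [measurable]: "f \<in> borel_measurable borel" and "0 \<le> c"
  shows "triangle_integral (\<lambda>z. c * f z) = ennreal c * triangle_integral f"
  unfolding triangle_integral_def
  using assms(2) by (subst nn_integral_cmult[symmetric]) (auto simp: ennreal_mult' mult.assoc)

lemma triangle_integral_sums: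
  assumes [measurable]: "\<And>n. g n \<in> borel_measurable borel"
    and "\<And>n x y. 0 < y \<Longrightarrow> y < x \<Longrightarrow> x < 1 \<Longrightarrow> 0 \<le> g n (x, y)"
    and "\<And>x y. 0 < y \<Longrightarrow> y < x \<Longrightarrow> x < 1 \<Longrightarrow> (\<lambda>n. g n (x, y)) sums f (x, y)"
  shows "triangle_integral f = (\<Sum>n. triangle_integral (g n))"
proof -
  have "triangle_integral f = (\<integral>\<^sup>+z. (\<Sum>n. ennreal (g n z) * indicator unit_triangle z) \<partial>lborel)"
    unfolding triangle_integral_def
  proof (intro nn_integral_cong)
    fix z
    show "ennreal (f z) * indicator unit_triangle z = (\<Sum>n. ennreal (g n z) * indicator unit_triangle z)"
    proof (cases "z \<in> unit_triangle")
      case True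
      then have "(\<Sum>n. ennreal (g n z)) = ennreal (f z)"
        using assms(2,3) by (intro suminf_ennreal_eq) (auto simp: unit_triangle_def)
      with True show ?thesis by simp
    qed simp
  qed
  also have "\<dots> = (\<Sum>n. triangle_integral (g n))"
    unfolding triangle_integral_def by (rule nn_integral_suminf) measurable
  finally show ?thesis .
qed

lemma
  assumes [measurable]: "f \<in> borel_measurable borel"
  shows triangle_integral_iterated:
      "triangle_integral f = (\<integral>\<^sup>+x. \<integral>\<^sup>+y. ennreal (f (x, y)) * indicator unit_triangle (x, y) \<partial>lborel \<partial>lborel)"
    and triangle_integral_iterated':
      "triangle_integral f = (\<integral>\<^sup>+y. \<integral>\<^sup>+x. ennreal (f (x, y)) * indicator unit_triangle (x, y) \<partial>lborel \<partial>lborel)"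
proof -
  have *: "(\<lambda>z. ennreal (f z) * indicator unit_triangle z) \<in> borel_measurable (lborel \<Otimes>\<^sub>M lborel)"
    unfolding lborel_prod by measurable
  show "triangle_integral f = (\<integral>\<^sup>+x. \<integral>\<^sup>+y. ennreal (f (x, y)) * indicator unit_triangle (x, y) \<partial>lborel \<partial>lborel)"
    using lborel.nn_integral_fst[OF *] by (simp add: triangle_integral_def lborel_prod)
  show "triangle_integral f = (\<integral>\<^sup>+y. \<integral>\<^sup>+x. ennreal (f (x, y)) * indicator unit_triangle (x, y) \<partial>lborel \<partial>lborel)"
    using lborel_pair.nn_integral_snd[OF *] by (simp add: triangle_integral_def lborel_prod)
qed

text \<open>
  With barycentric coordinates \<open>(1 - x, x - y, y)\<close>, this reflection exchanges the last two and the next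
  one exchanges the first two; together they generate all symmetries of the triangle.
  Each fixes one Cartesian coordinate, so by Fubini one-dimensional substitution suffices.
\<close>

lemma triangle_integral_reflect_y:
  assumes f [measurable]: "f \<in> borel_measurable borel"
  shows "triangle_integral (\<lambda>(x, y). f (x, x - y)) = triangle_integral f"
proof -
  have f' [measurable]: "(\<lambda>(x, y). f (x, x - y)) \<in> borel_measurable borel"
    unfolding case_prod_unfold
    by (rule measurable_compose[OF _ f]) (intro borel_measurable_continuous_onI continuous_intros)
  have "triangle_integral f =
      (\<integral>\<^sup>+x. \<integral>\<^sup>+y. ennreal (f (x, x - y)) * indicator unit_triangle (x, x - y) \<partial>lborel \<partial>lborel)"
    unfolding triangle_integral_iterated[OF f]
  proof (rule nn_integral_cong)
    fix x :: real
    show "(\<integral>\<^sup>+y. ennreal (f (x, y)) * indicator unit_triangle (x, y) \<partial>lborel) =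
        (\<integral>\<^sup>+y. ennreal (f (x, x - y)) * indicator unit_triangle (x, x - y) \<partial>lborel)"
      by (subst nn_integral_real_affine[where c = "-1" and t = x]) simp_all
  qed
  also have "\<dots> = triangle_integral (\<lambda>(x, y). f (x, x - y))"
    unfolding triangle_integral_iterated[OF f']
    by (auto simp: unit_triangle_def indicator_def intro!: nn_integral_cong)
  finally show ?thesis ..
qed

lemma triangle_integral_reflect_x:
  assumes f [measurable]: "f \<in> borel_measurable borel"
  shows "triangle_integral (\<lambda>(x, y). f (1 - x + y, y)) = triangle_integral f"
proof -
  have f' [measurable]: "(\<lambda>(x, y). f (1 - x + y, y)) \<in> borel_measurable borel"
    unfolding case_prod_unfold
    by (rule measurable_compose[OF _ f]) (intro borel_measurable_continuous_onI continuous_intros)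
  have "triangle_integral f =
      (\<integral>\<^sup>+y. \<integral>\<^sup>+x. ennreal (f (1 - x + y, y)) * indicator unit_triangle (1 - x + y, y) \<partial>lborel \<partial>lborel)"
    unfolding triangle_integral_iterated'[OF f]
  proof (rule nn_integral_cong)
    fix y :: real
    show "(\<integral>\<^sup>+x. ennreal (f (x, y)) * indicator unit_triangle (x, y) \<partial>lborel) =
        (\<integral>\<^sup>+x. ennreal (f (1 - x + y, y)) * indicator unit_triangle (1 - x + y, y) \<partial>lborel)"
      by (subst nn_integral_real_affine[where c = "-1" and t = "1 + y"]) (simp_all add: algebra_simps)
  qed
  also have "\<dots> = triangle_integral (\<lambda>(x, y). f (1 - x + y, y))"
    unfolding triangle_integral_iterated'[OF f']
    by (auto simp: unit_triangle_def indicator_def intro!: nn_integral_cong)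
  finally show ?thesis ..
qed

lemma nn_integral_power_open_interval:
  fixes a c :: real
  assumes "0 \<le> a" "0 \<le> c"
  shows "(\<integral>\<^sup>+y. ennreal (c * y ^ m) * indicator {0<..<a} y \<partial>lborel) = ennreal (c * a ^ (m + 1) / (m + 1))"
proof -
  have "(\<integral>\<^sup>+y. ennreal (c * y ^ m) * indicator {0<..<a} y \<partial>lborel) =
      (\<integral>\<^sup>+y. ennreal (c * y ^ m) * indicator {0..a} y \<partial>lborel)"
    using AE_lborel_singleton[of 0] AE_lborel_singleton[of a]
    by (intro nn_integral_cong_AE, eventually_elim) (auto simp: indicator_def)
  also have "\<dots> = ennreal (c * a ^ (m + 1) / (m + 1) - c * 0 ^ (m + 1) / (m + 1))"
    using assms
  proof (intro nn_integral_FTC_Icc)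
    fix y :: real
    show "((\<lambda>y. c * y ^ (m + 1) / (m + 1)) has_real_derivative c * y ^ m) (at y)"
      using DERIV_cmult[OF DERIV_pow[of "m + 1" y UNIV], of "c / (real m + 1)"]
      by (simp del: power_Suc add: add.commute)
  qed auto
  finally show ?thesis by simp
qed

lemma measurable_power_over: "(\<lambda>(x, y). y ^ m / x :: real) \<in> borel_measurable borel"
  unfolding borel_prod[symmetric] by measurable

lemma triangle_integral_power:
  "triangle_integral (\<lambda>(x, y). y ^ m / x) = ennreal (1 / (real m + 1)\<^sup>2)"
proof -
  have "triangle_integral (\<lambda>(x, y). y ^ m / x) =
      (\<integral>\<^sup>+x. \<integral>\<^sup>+y. ennreal (y ^ m / x) * indicator unit_triangle (x, y) \<partial>lborel \<partial>lborel)"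
    by (subst triangle_integral_iterated) (auto simp: measurable_power_over)
  also have "\<dots> = (\<integral>\<^sup>+x. ennreal (1 / (real m + 1) * x ^ m) * indicator {0<..<1} x \<partial>lborel)"
  proof (rule nn_integral_cong)
    fix x :: real
    show "(\<integral>\<^sup>+y. ennreal (y ^ m / x) * indicator unit_triangle (x, y) \<partial>lborel) =
        ennreal (1 / (real m + 1) * x ^ m) * indicator {0<..<1} x"
    proof (cases "x \<in> {0<..<1}")
      case True
      then have "(\<integral>\<^sup>+y. ennreal (y ^ m / x) * indicator unit_triangle (x, y) \<partial>lborel) =
          (\<integral>\<^sup>+y. ennreal ((1 / x) * y ^ m) * indicator {0<..<x} y \<partial>lborel)"
        by (intro nn_integral_cong) (auto simp: unit_triangle_def indicator_def)
      also have "\<dots> = ennreal ((1 / x) * x ^ (m + 1) / (m + 1))"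
        using True by (intro nn_integral_power_open_interval) auto
      finally show ?thesis
        using True by simp
    next
      case False
      then have "indicator unit_triangle (x, y) = (0 :: ennreal)" for y
        by (auto simp: unit_triangle_def indicator_def)
      with False show ?thesis by simp
    qed
  qed
  also have "\<dots> = ennreal (1 / (real m + 1) * 1 ^ (m + 1) / (m + 1))"
    by (rule nn_integral_power_open_interval) auto
  finally show ?thesis
    by (simp add: power2_eq_square add.commute)
qed

text \<open>
  Expanding \<open>1 / (1 - y)\<close> turns the integral into \<open>\<Sum>1 / (n + 1)\<^sup>2\<close>.
\<close>

lemma triangle_integral_geometric:
  "triangle_integral (\<lambda>(x, y). 1 / (x * (1 - y))) = ennreal (pi\<^sup>2 / 6)"
proof -
  have "triangle_integral (\<lambda>(x, y). 1 / (x * (1 - y))) = (\<Sum>n. triangle_integral (\<lambda>(x, y). y ^ n / x))"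
  proof (rule triangle_integral_sums)
    fix x y :: real
    assume "0 < y" "y < x" "x < 1"
    then have "(\<lambda>n. y ^ n / x) sums ((1 / (1 - y)) / x)"
      by (intro sums_divide geometric_sums) auto
    then show "(\<lambda>n. case (x, y) of (x, y) \<Rightarrow> y ^ n / x) sums (case (x, y) of (x, y) \<Rightarrow> 1 / (x * (1 - y)))"
      by (simp add: mult.commute)
  qed (auto simp: measurable_power_over)
  also have "\<dots> = ennreal (pi\<^sup>2 / 6)"
    unfolding triangle_integral_power
    by (rule suminf_ennreal_eq) (use inverse_squares_sums in \<open>auto simp: add.commute\<close>)
  finally show ?thesis .
qed

lemma triangle_integral_odd_geometric:
  "triangle_integral (\<lambda>(x, y). 2 * y / (x * (1 - y\<^sup>2))) = ennreal (pi\<^sup>2 / 12)"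
proof -
  have "triangle_integral (\<lambda>(x, y). 2 * y / (x * (1 - y\<^sup>2))) =
      (\<Sum>n. triangle_integral (\<lambda>z. 2 * (case z of (x, y) \<Rightarrow> y ^ (2 * n + 1) / x)))"
  proof (rule triangle_integral_sums)
    fix x y :: real
    assume *: "0 < y" "y < x" "x < 1"
    then have "y\<^sup>2 < 1"
      by (simp add: power_less_one_iff)
    then have "(\<lambda>n. 2 * y / x * (y\<^sup>2) ^ n) sums (2 * y / x * (1 / (1 - y\<^sup>2)))"
      by (intro sums_mult geometric_sums) auto
    moreover have "2 * y / x * (y\<^sup>2) ^ n = 2 * (y ^ (2 * n + 1) / x)" for n
      by (simp add: power_mult)
    ultimately show "(\<lambda>n. 2 * (case (x, y) of (x, y) \<Rightarrow> y ^ (2 * n + 1) / x)) sums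
        (case (x, y) of (x, y) \<Rightarrow> 2 * y / (x * (1 - y\<^sup>2)))"
      by (simp only: prod.case times_divide_times_eq mult_1_right)
  qed (auto simp: borel_prod[symmetric])
  also have "\<dots> = (\<Sum>n. ennreal (1 / 2 * (1 / (real n + 1)\<^sup>2)))"
  proof (rule suminf_cong)
    fix n :: nat
    have "triangle_integral (\<lambda>z. 2 * (case z of (x, y) \<Rightarrow> y ^ (2 * n + 1) / x)) =
        ennreal 2 * ennreal (1 / (real (2 * n + 1) + 1)\<^sup>2)"
      by (simp only: triangle_integral_cmult[OF measurable_power_over] triangle_integral_power zero_le_numeral)
    also have "\<dots> = ennreal (2 * (1 / (real (2 * n + 1) + 1)\<^sup>2))"
      by (subst ennreal_mult) auto
    also have "2 * (1 / (real (2 * n + 1) + 1)\<^sup>2) = 1 / 2 * (1 / (real n + 1)\<^sup>2)"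
      by (simp add: power2_eq_square divide_simps) (simp add: algebra_simps)
    finally show "triangle_integral (\<lambda>z. 2 * (case z of (x, y) \<Rightarrow> y ^ (2 * n + 1) / x)) =
        ennreal (1 / 2 * (1 / (real n + 1)\<^sup>2))"
      by (simp add: add.commute)
  qed
  also have "\<dots> = ennreal (1 / 2 * (pi\<^sup>2 / 6))"
    by (rule suminf_ennreal_eq) (use sums_mult[OF inverse_squares_sums, of "1 / 2"] in \<open>auto simp: add.commute\<close>)
  finally show ?thesis by simp
qed

text \<open>
  Direct expansion of \<open>1 / (1 + y)\<close> would give a series with alternating signs, which the nonnegative
  integral does not admit.  The identity \<open>1 / (1 - y) = 1 / (1 + y) + 2 y / (1 - y\<^sup>2)\<close> expresses the
  integral as a difference of two integrals with positive series.
\<close>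

lemma triangle_integral_alternating:
  "triangle_integral (\<lambda>(x, y). 1 / (x * (y + 1))) = ennreal (pi\<^sup>2 / 12)"
proof -
  let ?f = "\<lambda>(x, y). 1 / (x * (y + 1)) :: real" and ?g = "\<lambda>(x, y). 2 * y / (x * (1 - y\<^sup>2)) :: real"
  have "ennreal (pi\<^sup>2 / 6) = triangle_integral (\<lambda>z. ?f z + ?g z)"
    unfolding triangle_integral_geometric[symmetric]
  proof (rule triangle_integral_cong)
    fix x y :: real
    assume *: "0 < y" "y < x" "x < 1"
    have "1 - y\<^sup>2 = (1 - y) * (1 + y)"
      by (simp add: power2_eq_square algebra_simps)
    with * show "(\<lambda>(x, y). 1 / (x * (1 - y))) (x, y) = ?f (x, y) + ?g (x, y)"
      by (simp add: divide_simps) (simp add: algebra_simps)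
  qed
  also have "\<dots> = triangle_integral ?f + triangle_integral ?g"
    by (intro triangle_integral_add) (simp_all add: power_le_one borel_prod[symmetric])
  finally have "ennreal (pi\<^sup>2 / 6) = triangle_integral ?f + ennreal (pi\<^sup>2 / 12)"
    by (simp add: triangle_integral_odd_geometric)
  moreover have "ennreal (pi\<^sup>2 / 6) = ennreal (pi\<^sup>2 / 12) + ennreal (pi\<^sup>2 / 12)"
    by (subst ennreal_plus[symmetric]) auto
  ultimately show ?thesis
    by (metis ennreal_add_diff_cancel_right ennreal_neq_top)
qed

text \<open>
  The denominators fall into two orbits under the symmetries of the triangle, represented by
  \<open>x (y + 1)\<close> and \<open>x (1 - y)\<close>.
\<close>

lemma listed_densities_triangle_integral:
  assumes "(t, r) \<in> listed_densities"
  shows "triangle_integral r = 1"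
proof -
  have scale: "triangle_integral (\<lambda>(x, y). c / (pi\<^sup>2 * g x y)) = 1"
    if "triangle_integral (\<lambda>(x, y). 1 / g x y) = ennreal (pi\<^sup>2 / c)" "0 < c"
      and "(\<lambda>(x, y). 1 / g x y) \<in> borel_measurable borel" for c and g :: "real \<Rightarrow> real \<Rightarrow> real"
  proof -
    have "triangle_integral (\<lambda>(x, y). c / (pi\<^sup>2 * g x y)) =
        triangle_integral (\<lambda>z. c / pi\<^sup>2 * (\<lambda>(x, y). 1 / g x y) z)"
      by (rule triangle_integral_cong) simp
    also have "\<dots> = ennreal (c / pi\<^sup>2) * ennreal (pi\<^sup>2 / c)"
      using that by (subst triangle_integral_cmult) auto
    also have "\<dots> = 1"
      using that(2) by (subst ennreal_mult[symmetric]) auto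
    finally show ?thesis .
  qed
  let ?I = triangle_integral
  have m: "(\<lambda>(x, y). c / (pi\<^sup>2 * x * (y + 1))) \<in> borel_measurable borel"
    "(\<lambda>(x, y). c / (pi\<^sup>2 * x * (1 - y))) \<in> borel_measurable borel"
    "(\<lambda>(x, y). c / (pi\<^sup>2 * (y + 1) * (1 - x + y))) \<in> borel_measurable borel"
    "(\<lambda>(x, y). c / (pi\<^sup>2 * (1 - y) * (x - y + 1))) \<in> borel_measurable borel"
    "(\<lambda>(x, y). c / (pi\<^sup>2 * (2 - x) * (1 - y))) \<in> borel_measurable borel"
    "(\<lambda>(x, y). c / (pi\<^sup>2 * x * (1 - x + y))) \<in> borel_measurable borel" for c :: real
    unfolding borel_prod[symmetric] by measurable
  have a1: "?I (\<lambda>(x, y). 12 / (pi\<^sup>2 * x * (y + 1))) = 1"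
    using scale[of "\<lambda>x y. x * (y + 1)" 12] triangle_integral_alternating
    by (simp add: mult.assoc borel_prod[symmetric])
  have a2: "?I (\<lambda>(x, y). 12 / (pi\<^sup>2 * (y + 1) * (1 - x + y))) = 1"
    using triangle_integral_reflect_x[OF m(1), of 12] a1 by (simp add: mult_ac)
  have a3: "?I (\<lambda>(x, y). 12 / (pi\<^sup>2 * x * (x - y + 1))) = 1"
    using triangle_integral_reflect_y[OF m(1), of 12] a1 by simp
  have a4: "?I (\<lambda>(x, y). 12 / (pi\<^sup>2 * (1 - y) * (x - y + 1))) = 1"
    using triangle_integral_reflect_y[OF m(3), of 12] a2 by (simp add: mult_ac)
  have a5: "?I (\<lambda>(x, y). 12 / (pi\<^sup>2 * (2 - x) * (1 - y))) = 1"
    using triangle_integral_reflect_x[OF m(4), of 12] a4 by (simp add: mult_ac)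
  have a6: "?I (\<lambda>(x, y). 12 / (pi\<^sup>2 * (2 - x) * (1 - x + y))) = 1"
    using triangle_integral_reflect_y[OF m(5), of 12] a5 by (simp add: algebra_simps)
  have b1: "?I (\<lambda>(x, y). 6 / (pi\<^sup>2 * x * (1 - y))) = 1"
    using scale[of "\<lambda>x y. x * (1 - y)" 6] triangle_integral_geometric
    by (simp add: mult.assoc borel_prod[symmetric])
  have b2: "?I (\<lambda>(x, y). 6 / (pi\<^sup>2 * x * (1 - x + y))) = 1"
    using triangle_integral_reflect_y[OF m(2), of 6] b1 by (simp add: algebra_simps)
  have b3: "?I (\<lambda>(x, y). 6 / (pi\<^sup>2 * (1 - y) * (1 - x + y))) = 1"
    using triangle_integral_reflect_x[OF m(2), of 6] b1 by (simp add: mult_ac)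
  show ?thesis
    using assms a1 a2 a3 a4 a5 a6 b1 b2 b3 unfolding listed_densities_def by auto
qed

lemma listed_densities_measurable:
  "(t, r) \<in> listed_densities \<Longrightarrow> r \<in> borel_measurable borel"
  unfolding listed_densities_def borel_prod[symmetric] by auto

lemma prob_space_density_measure:
  assumes "(t, r) \<in> listed_densities"
  shows "prob_space (density_measure r)"
proof
  have [measurable]: "r \<in> borel_measurable borel"
    using assms by (rule listed_densities_measurable)
  have tri: "unit_triangle \<in> sets lebesgue"
    by simp
  have meas: "(\<lambda>z. ennreal (r z)) \<in> borel_measurable (lebesgue_on unit_triangle)"
    by (intro measurable_restrict_space1 measurable_completion) simp
  have "emeasure (density_measure r) (space (density_measure r)) =
      (\<integral>\<^sup>+z. ennreal (r z) * indicator unit_triangle z \<partial>lebesgue_on unit_triangle)"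
    using meas tri by (simp add: density_measure_def emeasure_density space_restrict_space sets_restrict_space_iff)
  also have "\<dots> = (\<integral>\<^sup>+z. ennreal (r z) * indicator unit_triangle z * indicator unit_triangle z \<partial>lebesgue)"
    by (subst nn_integral_restrict_space) simp_all
  also have "\<dots> = triangle_integral r"
    unfolding triangle_integral_def nn_integral_completion
    by (intro nn_integral_cong) (simp add: indicator_def)
  finally show "emeasure (density_measure r) (space (density_measure r)) = 1"
    using listed_densities_triangle_integral[OF assms] by simp
qed

section \<open>Digit frequencies\<close>

lemma has_expansion_iff: "has_expansion t z \<longleftrightarrow> (\<forall>i. (tp_map t ^^ i) z \<in> tp_domain t)"
  unfolding has_expansion_def by (metis diff_Suc_1 le_add1 plus_1_eq_Suc)

text \<open>
  Digits are numbered from \<open>1\<close> and iterates from \<open>0\<close>, which is the reason for the shift by \<open>Suc\<close>.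
\<close>

lemma digit_freq_eq:
  assumes "has_expansion t z"
  shows "digit_freq t n k z = (\<Sum>i<n. indicator (subtriangle t k) ((tp_map t ^^ i) z)) / n"
proof -
  let ?S = "{i. i < n \<and> (tp_map t ^^ i) z \<in> subtriangle t k}"
  have "{i. 1 \<le> i \<and> i \<le> n \<and> digit t z i = k} = Suc ` ?S"
  proof (intro set_eqI iffI)
    fix i
    assume "i \<in> {i. 1 \<le> i \<and> i \<le> n \<and> digit t z i = k}"
    moreover from this obtain j where "i = Suc j"
      by (cases i) auto
    ultimately show "i \<in> Suc ` ?S"
      using assms by (auto simp: has_expansion_iff digit_def cell_index_eq_iff)
  qed (use assms in \<open>auto simp: has_expansion_iff digit_def cell_index_eq_iff\<close>)
  then have "card {i. 1 \<le> i \<and> i \<le> n \<and> digit t z i = k} = card ?S"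
    by (simp add: card_image)
  moreover have "(\<Sum>i<n. indicator (subtriangle t k) ((tp_map t ^^ i) z)) = real (card ?S)"
    by (simp add: indicator_def sum.If_cases Int_def conj_commute)
  ultimately show ?thesis
    by (simp add: digit_freq_def)
qed

theorem theorem8:
  fixes t :: triple and r :: "real \<times> real \<Rightarrow> real"
  assumes "(t, r) \<in> listed_densities"
    and "ergodic_wrt (lebesgue_on unit_triangle) (tp_domain t) (tp_map t)"
    and "invariant_under (density_measure r) (tp_domain t) (tp_map t)"
    and "absolutely_continuous (lebesgue_on unit_triangle) (density_measure r)"
    and "absolutely_continuous (density_measure r) (lebesgue_on unit_triangle)"
  shows "\<forall>k. (AE z in lebesgue_on unit_triangle. has_digit_density t k z (digit_density t k)) \<and>
             digit_density t k = (LINT z:subtriangle t k|density_measure r. 1)"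
proof
  fix k
  let ?L = "lebesgue_on unit_triangle" and ?M = "density_measure r"
  interpret prob_space ?M
    using assms(1) by (rule prob_space_density_measure)
  have sets_eq: "sets ?M = sets ?L" and space_eq: "space ?M = unit_triangle" "space ?L = unit_triangle"
    by (simp_all add: density_measure_def space_restrict_space)
  have null: "null_sets ?L = null_sets ?M"
    using assms(4,5) by (auto simp: absolutely_continuous_def)
  have AE_eq: "(AE z in ?L. P z) \<longleftrightarrow> (AE z in ?M. P z)" for P
    by (simp add: eventually_ae_filter null space_eq)
  have erg: "ergodic_wrt ?M (tp_domain t) (tp_map t)"
    using assms(2) by (simp add: ergodic_wrt_def null sets_eq space_eq)
  let ?E = "subtriangle t k"
  have E: "?E \<in> sets ?M"
    using open_subtriangle[of t k] subtriangle_subset[of t k]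
    by (auto simp: sets_eq sets_restrict_space_iff)
  define c :: real where "c = (LINT z:?E|?M. 1)"
  have c: "c = (\<integral>z. indicator ?E z \<partial>?M)"
    by (simp add: c_def set_lebesgue_integral_def)
  have "integrable ?M (indicator ?E :: _ \<Rightarrow> real)"
    using E by (simp add: integrable_indicator_iff emeasure_finite less_top[symmetric])
  then have "AE z in ?M. (\<forall>i. (tp_map t ^^ i) z \<in> tp_domain t) \<and>
      (\<lambda>n. (\<Sum>i<n. indicator ?E ((tp_map t ^^ i) z)) / n) \<longlonglongrightarrow> c"
    unfolding c using assms(3) erg prob_space_axioms
    by (intro birkhoff_ergodic_partial) (auto simp: space_eq tp_map_in_triangle)
  then have dens: "AE z in ?L. has_digit_density t k z c"
    unfolding AE_eq
    by eventually_elim (simp add: has_digit_density_def digit_freq_eq has_expansion_iff)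
  \<comment> \<open>Limits are unique and \<open>?M\<close> is not the zero measure, so the almost sure value is unique.\<close>
  have "digit_density t k = c"
    unfolding digit_density_def
  proof (rule the_equality)
    fix d
    assume "AE z in ?L. has_digit_density t k z d"
    then have "AE z in ?M. d = c"
      using dens unfolding AE_eq
      by eventually_elim (auto simp: has_digit_density_def intro: LIMSEQ_unique)
    then show "d = c"
      by simp
  qed (rule dens)
  then show "(AE z in ?L. has_digit_density t k z (digit_density t k)) \<and>
      digit_density t k = (LINT z:?E|?M. 1)"
    using dens by (simp add: c_def)
qed

end
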